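(* Consider the problem $$u_t-u_{xx}=h(t),\quad (x,t)\in[0,\pi]\times[0,\infty),$$ $$u(0,t)=v(t),\quad u(\pi,t)=0,\quad u(x,0)=g(x),$$ where the three functions $h=h(t)$, $v=v(t)$ ($t\ge 0$) and $g=g(x)$ ($0\le x\le \pi$) are unknown. For $m=1,2,\dots$ let $f_m(x)=\sqrt{\frac{2}{\pi}}\,\sin(mx)$ and $u_m(t)=\int_0^\pi u(x,t)f_m(x)\,dx$. Let $y\in(0,\pi)$ be a fixed point such that $f_m(y)\neq 0$ for all $m=1,2,\dots$. Then the three functions $\{u_1(t),\,u_3(t),\,u(y,t)\}$, known for all $t\ge 0$, determine the triple $\{h,v,g\}$ uniquely. That is, if $u$ satisfies $u_t-u_{xx}=h(t)$ for $(x,t)\in[0,\pi]\times[0,\infty)$, $u(0,t)=v(t)$, $u(\pi,t)=0$, $u(x,0)=g(x)$, and $\tilde u$ satisfies $\tilde u_t-\tilde u_{xx}=\tilde h(t)$ for $(x,t)\in[0,\pi]\times[0,\infty)$, $\tilde u(0,t)=\tilde v(t)$, $\tilde u(\pi,t)=0$, $\tilde u(x,0)=\tilde g(x)$, and if $u_1(t)=\tilde u_1(t)$, $u_3(t)=\tilde u_3(t)$ and $u(y,t)=\tilde u(y,t)$ for all $t\ge 0$, then $h=\tilde h$, $v=\tilde v$ and $g=\tilde g$.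
   Context: The functions $f_m(x)=\sqrt{2/\pi}\,\sin(mx)$, $m=1,2,\dots$, are the eigenfunctions satisfying $f_m''+m^2f_m=0$ on $[0,\pi]$, $f_m(0)=f_m(\pi)=0$, normalized by $\|f_m\|=1$, where $\|f\|:=\|f\|_{L^2(0,\pi)}$. For a function $u(x,t)$, $u_m(t):=(u,f_m)=\int_0^\pi u(x,t)f_m(x)\,dx$ denotes its $m$-th coefficient with respect to $f_m$ (and $\tilde u_m$ is defined in the same way from $\tilde u$). Subscripts $t$ and $xx$ on $u$ denote partial derivatives. *)

theory Defs
  imports "HOL-Analysis.Analysis"
begin

definition eigf :: "nat \<Rightarrow> real \<Rightarrow> real" where
  "eigf m x = sqrt (2 / pi) * sin (real m * x)"

definition coef :: "(real \<Rightarrow> real \<Rightarrow> real) \<Rightarrow> nat \<Rightarrow> real \<Rightarrow> real" where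
  "coef u m t = integral {0..pi} (\<lambda>x. u x t * eigf m x)"

text \<open>
  Classical solutions, with \<open>u x t\<close> standing for the value at position \<open>x\<close> and time \<open>t\<close>.
  The equation holds at every point of the closed strip, so derivatives at boundary points
  are one-sided (derivatives within the domain). The only regularity assumed beyond existence
  of these derivatives is the usual one for classical solutions: \<open>u\<close> is continuous on the closed
  strip, and \<open>u\<^sub>t\<close> and \<open>u\<^sub>x\<^sub>x\<close> are continuous in its interior. No separate assumption is
  made on \<open>h\<close>, \<open>v\<close>, \<open>g\<close>; their values outside \<open>[0,\<infinity>)\<close>, \<open>[0,\<infinity>)\<close>, \<open>[0,\<pi>]\<close> are irrelevant.
\<close>

definition heat_solution ::
  "(real \<Rightarrow> real \<Rightarrow> real) \<Rightarrow> (real \<Rightarrow> real) \<Rightarrow> (real \<Rightarrow> real) \<Rightarrow> (real \<Rightarrow> real) \<Rightarrow> bool"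
where
  "heat_solution u h v g \<longleftrightarrow>
     continuous_on ({0..pi} \<times> {0..}) (\<lambda>(x, t). u x t) \<and>
     (\<exists>ut ux uxx.
        continuous_on ({0<..<pi} \<times> {0<..}) (\<lambda>(x, t). ut x t) \<and>
        continuous_on ({0<..<pi} \<times> {0<..}) (\<lambda>(x, t). uxx x t) \<and>
        (\<forall>x\<in>{0..pi}. \<forall>t\<in>{0..}.
           ((\<lambda>s. u x s) has_real_derivative ut x t) (at t within {0..}) \<and>
           ((\<lambda>z. u z t) has_real_derivative ux x t) (at x within {0..pi}) \<and>
           ((\<lambda>z. ux z t) has_real_derivative uxx x t) (at x within {0..pi}) \<and>
           ut x t - uxx x t = h t)) \<and>
     (\<forall>t\<in>{0..}. u 0 t = v t) \<and>
     (\<forall>t\<in>{0..}. u pi t = 0) \<and>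
     (\<forall>x\<in>{0..pi}. u x 0 = g x)"

end

theory Submission
  imports Defs "HOL-Real_Asymp.Real_Asymp"
begin

text \<open>
  By linearity it suffices to treat the difference \<open>w\<close> of the two solutions, which solves a
  problem of the same type with \<open>w\<^sub>1 = w\<^sub>3 = 0\<close> and \<open>w(y, \<cdot>) = 0\<close>.

  Pairing the equation with \<open>sin (m x)\<close> gives, for the sine coefficient \<open>S\<^sub>m\<close> of \<open>w\<close>,
  \[ S_m' = m v - m^2 S_m + \frac{1 - (-1)^m}{m} h \qquad (t > 0), \]
  which is \<open>sine_coef_ode\<close>. For \<open>m = 1\<close> and \<open>m = 3\<close> the left side and \<open>S\<^sub>m\<close> vanish, so
  \<open>v + 2 h = 0\<close> and \<open>3 v + (2/3) h = 0\<close>. These equations are independent, because the source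
  enters with the weight \<open>2/m\<close> and the boundary value with the weight \<open>m\<close>. So \<open>h = v = 0\<close> for
  positive times, hence \<open>S\<^sub>m(t) = S\<^sub>m(0) exp (- m\<^sup>2 t)\<close>, and \<open>w(\<cdot>, t)\<close> is the sum of its sine
  series (\<open>sine_expansion\<close>). At \<open>x = y\<close> this reads \<open>\<Sum>\<^sub>m S\<^sub>m(0) sin (m y) exp (- m\<^sup>2 t) = 0\<close> for
  all \<open>t > 0\<close>. Exponentials with distinct rates are independent (\<open>exp_squares_independent\<close>)
  and no \<open>sin (m y)\<close> with \<open>m \<ge> 1\<close> vanishes, so every \<open>S\<^sub>m(0)\<close> is zero. By completeness of the sines
  (\<open>sine_system_complete\<close>) \<open>w\<close> vanishes identically, and so do its initial and boundary values
  and, by the equation itself, the source, also at time \<open>0\<close>.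

  The analytic difficulty is the equation for \<open>S\<^sub>m\<close>: the derivatives of a classical solution need not
  be bounded near the boundary of the strip, so one can neither differentiate the coefficient
  under the integral nor exchange the two integrations over the full interval. The computation is therefore
  done on a slightly shorter interval, compressing the strip towards its centre. The test
  function is compressed as well, so that it still vanishes at the ends of the shorter
  interval and the boundary term containing \<open>w\<^sub>x\<close> disappears. What remains involves only \<open>w\<close> and
  \<open>h\<close>, and continuity of \<open>w\<close> up to the boundary allows the passage to the full interval.
\<close>

section \<open>Sine series on an interval\<close>

definition sine_coef :: "(real \<Rightarrow> real) \<Rightarrow> nat \<Rightarrow> real" where
  "sine_coef f m = integral {0..pi} (\<lambda>x. f x * sin (real m * x))"

lemma sine_coef_integrable:
  assumes "continuous_on {0..pi} f"
  shows "(\<lambda>x. f x * sin (real m * x)) integrable_on {0..pi}"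
  by (intro integrable_continuous_real continuous_intros assms)

lemma sine_coef_diff:
  assumes "continuous_on {0..pi} f" "continuous_on {0..pi} g"
  shows "sine_coef (\<lambda>x. f x - g x) m = sine_coef f m - sine_coef g m"
  unfolding sine_coef_def left_diff_distrib
  by (intro integral_diff sine_coef_integrable assms)

lemma sine_coef_bounded:
  assumes "continuous_on {0..pi} f"
  obtains C where "\<And>m. \<bar>sine_coef f m\<bar> \<le> C"
proof
  fix m
  show "\<bar>sine_coef f m\<bar> \<le> integral {0..pi} (\<lambda>x. \<bar>f x\<bar>)"
    unfolding sine_coef_def real_norm_def[symmetric]
  proof (rule integral_norm_bound_integral)
    show "(\<lambda>x. norm (f x)) integrable_on {0..pi}"
      by (intro integrable_continuous_real continuous_intros assms)
    show "norm (f x * sin (real m * x)) \<le> norm (f x)" for x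
      by (simp add: abs_mult mult_left_le)
  qed (rule sine_coef_integrable[OF assms])
qed

text \<open>
  The product \<open>sin (m x) cos x\<close> is the average of \<open>sin ((m + 1) x)\<close> and \<open>sin ((m - 1) x)\<close>, so
  multiplication by powers of \<open>cos x\<close> does not leave the span of the sines.
\<close>

lemma integral_sin_cos_power_eq_0:
  assumes cont: "continuous_on {0..pi} f" and coef: "\<And>m. m \<ge> 1 \<Longrightarrow> sine_coef f m = 0"
  shows "integral {0..pi} (\<lambda>x. f x * sin (real m * x) * cos x ^ k) = 0"
proof (induction k arbitrary: m)
  case 0
  show ?case
    using coef[of m] by (cases "m = 0") (auto simp: sine_coef_def)
next
  case (Suc k)
  show ?case
  proof (cases "m = 0")
    case False
    have split: "f x * sin (real m * x) * cos x ^ Suc k =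
        (f x * sin (real (m + 1) * x) * cos x ^ k + f x * sin (real (m - 1) * x) * cos x ^ k) / 2" for x
    proof -
      have "real (m + 1) * x = real m * x + x" "real (m - 1) * x = real m * x - x"
        using False by (auto simp: algebra_simps of_nat_diff)
      then have "sin (real (m + 1) * x) = sin (real m * x) * cos x + cos (real m * x) * sin x"
        and "sin (real (m - 1) * x) = sin (real m * x) * cos x - cos (real m * x) * sin x"
        by (simp_all only: sin_add sin_diff)
      then show ?thesis
        by (simp only:) (simp add: algebra_simps)
    qed
    have int: "(\<lambda>x. f x * sin (real j * x) * cos x ^ k) integrable_on {0..pi}" for j
      by (intro integrable_continuous_real continuous_intros cont)
    show ?thesis
      unfolding split by (simp only: integral_divide integral_add[OF int int] Suc) simp
  qed simp
qed

text \<open>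
  A function orthogonal to all sines is orthogonal to \<open>sin x p(cos x)\<close> for every polynomial \<open>p\<close>.
  Since \<open>cos\<close> maps \<open>[0, \<pi>]\<close> bijectively onto \<open>[-1, 1]\<close>, the Weierstrass theorem for \<open>f \<circ> arccos\<close>
  makes \<open>p(cos x)\<close> uniformly close to \<open>f(x)\<close>. Hence the integral of \<open>f\<^sup>2 sin\<close> is zero, and its
  integrand is nonnegative.
\<close>

theorem sine_system_complete:
  assumes cont: "continuous_on {0..pi} f" and coef: "\<And>m. m \<ge> 1 \<Longrightarrow> sine_coef f m = 0"
    and x: "x \<in> {0..pi}"
  shows "f x = 0"
proof -
  define J where "J = integral {0..pi} (\<lambda>x. f x * f x * sin x)"
  have polynomial: "integral {0..pi} (\<lambda>x. f x * sin x * p (cos x)) = 0"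
    if "real_polynomial_function p" for p
  proof -
    obtain a n where p: "p = (\<lambda>z. \<Sum>i\<le>n. a i * z ^ i)"
      using \<open>real_polynomial_function p\<close> unfolding real_polynomial_function_iff_sum by blast
    have "integral {0..pi} (\<lambda>x. f x * sin x * p (cos x))
        = integral {0..pi} (\<lambda>x. \<Sum>i\<le>n. a i * (f x * sin (real 1 * x) * cos x ^ i))"
      by (simp add: p sum_distrib_left algebra_simps)
    also have "\<dots> = (\<Sum>i\<le>n. integral {0..pi} (\<lambda>x. a i * (f x * sin (real 1 * x) * cos x ^ i)))"
      by (intro integral_sum integrable_continuous_real continuous_intros cont) auto
    also have "\<dots> = 0"
      by (simp only: integral_mult_right integral_sin_cos_power_eq_0[OF cont coef]) simp
    finally show ?thesis .
  qed
  have small: "\<bar>J\<bar> \<le> integral {0..pi} (\<lambda>x. \<bar>f x\<bar>) * e" if "e > 0" for e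
  proof -
    have "continuous_on {-1..1} (\<lambda>z. f (arccos z))"
      by (rule continuous_on_compose2[OF cont]) (auto intro!: continuous_intros arccos_lbound arccos_ubound)
    then obtain p where p: "real_polynomial_function p"
      and close: "\<And>z. z \<in> {-1..1} \<Longrightarrow> \<bar>f (arccos z) - p z\<bar> < e"
      using Stone_Weierstrass_real_polynomial_function[of "{-1..1}"] \<open>e > 0\<close> by (metis compact_Icc)
    have close: "\<bar>f x - p (cos x)\<bar> < e" if "x \<in> {0..pi}" for x
      using close[of "cos x"] that by (simp add: arccos_cos)
    have contp: "continuous_on {0..pi} (\<lambda>x. p (cos x))"
      by (rule continuous_on_compose2[OF continuous_on_polymonial_function[of p UNIV]])
         (use p in \<open>auto simp: real_polynomial_function_eq intro!: continuous_intros\<close>)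
    have "J = integral {0..pi} (\<lambda>x. f x * f x * sin x) - integral {0..pi} (\<lambda>x. f x * sin x * p (cos x))"
      by (simp add: J_def polynomial[OF p])
    also have "\<dots> = integral {0..pi} (\<lambda>x. f x * f x * sin x - f x * sin x * p (cos x))"
      by (intro integral_diff[symmetric] integrable_continuous_real continuous_intros cont contp)
    finally have J: "J = \<dots>" .
    have "norm (integral {0..pi} (\<lambda>x. f x * f x * sin x - f x * sin x * p (cos x)))
        \<le> integral {0..pi} (\<lambda>x. \<bar>f x\<bar> * e)"
    proof (rule integral_norm_bound_integral)
      fix x assume x: "x \<in> {0..pi}"
      have "norm (f x * f x * sin x - f x * sin x * p (cos x)) = \<bar>f x\<bar> * (\<bar>f x - p (cos x)\<bar> * \<bar>sin x\<bar>)"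
        by (simp add: abs_mult[symmetric] algebra_simps)
      also have "\<dots> \<le> \<bar>f x\<bar> * (e * 1)"
        using close[OF x] by (intro mult_mono) auto
      finally show "norm (f x * f x * sin x - f x * sin x * p (cos x)) \<le> \<bar>f x\<bar> * e" by simp
    qed (intro integrable_continuous_real continuous_intros cont contp)+
    then show ?thesis by (simp add: J)
  qed
  have "J = 0"
  proof (rule ccontr)
    \<comment> \<open>Choosing \<open>e\<close> below \<open>\<bar>J\<bar> / K\<close> contradicts the estimate; \<open>K + 1\<close> avoids division by zero.\<close>
    assume "J \<noteq> 0"
    define K where "K = integral {0..pi} (\<lambda>x. \<bar>f x\<bar>)"
    have "K \<ge> 0" unfolding K_def
      by (intro integral_nonneg integrable_continuous_real continuous_intros cont) auto
    have "\<bar>J\<bar> \<le> K * (\<bar>J\<bar> / (2 * (K + 1)))"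
      using small[of "\<bar>J\<bar> / (2 * (K + 1))"] \<open>J \<noteq> 0\<close> \<open>K \<ge> 0\<close> by (simp add: K_def[symmetric])
    also have "\<dots> = \<bar>J\<bar> * (K / (2 * (K + 1)))" by simp
    also have "\<dots> < \<bar>J\<bar> * 1"
      using \<open>J \<noteq> 0\<close> \<open>K \<ge> 0\<close> by (intro mult_strict_left_mono) (auto simp: field_simps)
    finally show False by simp
  qed
  then have zero: "\<forall>x\<in>cbox 0 pi. f x * f x * sin x = 0"
    by (subst integral_cbox_eq_0_iff[symmetric])
       (auto simp: J_def box_eq_empty sin_ge_zero not_le intro!: continuous_intros cont)
  have "f x = 0" if "x \<in> {0<..<pi}" for x
    using zero that sin_gt_zero[of x] by force
  then show ?thesis
    using continuous_constant_on_closure[of "{0<..<pi}" f 0 x] cont x by simp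
qed

lemma integral_sin_mult_sin:
  assumes "n \<ge> 1"
  shows "integral {0..pi} (\<lambda>x. sin (real m * x) * sin (real n * x)) = (if m = n then pi / 2 else 0)"
proof (cases "m = n")
  case True
  have "((\<lambda>x. sin (real n * x) * sin (real n * x)) has_integral
     (pi / 2 - sin (2 * real n * pi) / (4 * real n)) - (0 / 2 - sin (2 * real n * 0) / (4 * real n))) {0..pi}"
  proof (rule fundamental_theorem_of_calculus)
    fix x
    have "1 / 2 - cos (2 * real n * x) / 2 = sin (real n * x) * sin (real n * x)"
      using cos_double_sin[of "real n * x"] by (simp add: power2_eq_square algebra_simps)
    moreover have "((\<lambda>x. x / 2 - sin (2 * real n * x) / (4 * real n)) has_real_derivative
        1 / 2 - cos (2 * real n * x) / 2) (at x within {0..pi})"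
      using assms by (auto intro!: derivative_eq_intros simp: field_simps)
    ultimately show "((\<lambda>x. x / 2 - sin (2 * real n * x) / (4 * real n)) has_vector_derivative
        sin (real n * x) * sin (real n * x)) (at x within {0..pi})"
      by (simp add: has_real_derivative_iff_has_vector_derivative)
  qed auto
  moreover have "sin (2 * real n * pi) = 0"
    using sin_npi[of "2 * n"] by simp
  ultimately show ?thesis using True by (auto dest!: integral_unique)
next
  case False
  define d s where "d = real m - real n" and "s = real m + real n"
  have ds: "d \<noteq> 0" "s \<noteq> 0" using False assms by (auto simp: d_def s_def)
  have "((\<lambda>x. sin (real m * x) * sin (real n * x)) has_integral
     (sin (d * pi) / (2 * d) - sin (s * pi) / (2 * s)) - (sin (d * 0) / (2 * d) - sin (s * 0) / (2 * s))) {0..pi}"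
  proof (rule fundamental_theorem_of_calculus)
    fix x
    have "cos (d * x) / 2 - cos (s * x) / 2 = sin (real m * x) * sin (real n * x)"
      by (simp add: d_def s_def left_diff_distrib distrib_right cos_add cos_diff) (simp add: field_simps)
    moreover have "((\<lambda>x. sin (d * x) / (2 * d) - sin (s * x) / (2 * s)) has_real_derivative
        cos (d * x) / 2 - cos (s * x) / 2) (at x within {0..pi})"
      using ds by (auto intro!: derivative_eq_intros simp: field_simps)
    ultimately show "((\<lambda>x. sin (d * x) / (2 * d) - sin (s * x) / (2 * s)) has_vector_derivative
        sin (real m * x) * sin (real n * x)) (at x within {0..pi})"
      by (simp add: has_real_derivative_iff_has_vector_derivative)
  qed auto
  moreover have "sin (d * pi) = 0" "sin (s * pi) = 0"
    by (auto simp: d_def s_def algebra_simps sin_add sin_diff)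
  ultimately show ?thesis using False by (auto dest!: integral_unique)
qed

text \<open>
  The sum of the series is continuous and, by orthogonality, has the same sine coefficients as \<open>f\<close>,
  so completeness identifies it with \<open>f\<close>. The hypothesis forces \<open>f\<close> to vanish at both
  ends. Solutions of the heat equation with zero boundary values satisfy it at positive times, because
  their coefficients then decay like \<open>exp (- m\<^sup>2 t)\<close>.
\<close>

theorem sine_expansion:
  assumes cont: "continuous_on {0..pi} f" and summ: "summable (\<lambda>m. \<bar>sine_coef f m\<bar>)"
    and x: "x \<in> {0..pi}"
  shows "(\<lambda>m. 2 / pi * sine_coef f m * sin (real m * x)) sums f x"
proof -
  define summand where "summand m x = 2 / pi * sine_coef f m * sin (real m * x)" for m x
  define F where "F x = (\<Sum>m. summand m x)" for x
  have bound: "norm (summand m x) \<le> 2 / pi * \<bar>sine_coef f m\<bar>" for m x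
    by (simp add: summand_def abs_mult mult_left_le divide_right_mono)
  have summ': "summable (\<lambda>m. 2 / pi * \<bar>sine_coef f m\<bar>)"
    by (rule summable_mult[OF summ])
  have cont_summand: "continuous_on A (summand m)" for A m
    unfolding summand_def by (intro continuous_intros)
  have unif: "uniform_limit {0..pi} (\<lambda>N x. \<Sum>m<N. summand m x) F sequentially"
    unfolding F_def by (rule Weierstrass_m_test[OF bound summ'])
  have contF: "continuous_on {0..pi} F"
    by (rule uniform_limit_theorem[OF _ unif]) (auto intro!: always_eventually continuous_intros cont_summand)
  have coefF: "sine_coef F n = sine_coef f n" if "n \<ge> 1" for n
  proof -
    have "uniform_limit {0..pi} (\<lambda>N x. (\<Sum>m<N. summand m x) * sin (real n * x)) (\<lambda>x. F x * sin (real n * x)) sequentially"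
    proof (rule uniform_lim_mult[OF unif uniform_limit_const])
      show "bounded (F ` {0..pi})"
        by (intro compact_imp_bounded compact_continuous_image contF) auto
      show "bounded ((\<lambda>x. sin (real n * x)) ` {0..pi})"
        by (intro compact_imp_bounded compact_continuous_image continuous_intros) auto
    qed
    then obtain I J where I: "\<And>N. ((\<lambda>x. (\<Sum>m<N. summand m x) * sin (real n * x)) has_integral I N) {0..pi}"
      and J: "((\<lambda>x. F x * sin (real n * x)) has_integral J) {0..pi}" and lim: "I \<longlonglongrightarrow> J"
      by (rule uniform_limit_integral) (auto intro!: continuous_intros cont_summand)
    have "I N = sine_coef f n" if "N > n" for N
    proof -
      have "I N = integral {0..pi} (\<lambda>x. (\<Sum>m<N. summand m x) * sin (real n * x))"
        by (rule integral_unique[OF I, symmetric])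
      also have "\<dots> = integral {0..pi} (\<lambda>x. \<Sum>m<N. 2 / pi * sine_coef f m * (sin (real m * x) * sin (real n * x)))"
        by (simp add: summand_def sum_distrib_right mult.assoc)
      also have "\<dots> = (\<Sum>m<N. integral {0..pi} (\<lambda>x. 2 / pi * sine_coef f m * (sin (real m * x) * sin (real n * x))))"
        by (intro integral_sum integrable_continuous_real continuous_intros) auto
      also have "\<dots> = (\<Sum>m<N. if m = n then sine_coef f m else 0)"
        by (simp only: integral_mult_right integral_sin_mult_sin[OF \<open>n \<ge> 1\<close>]) (intro sum.cong, auto)
      also have "\<dots> = sine_coef f n" using that by (simp add: sum.delta)
      finally show ?thesis .
    qed
    then have "I \<longlonglongrightarrow> sine_coef f n"
      by (intro tendsto_eventually eventually_sequentiallyI[of "Suc n"]) auto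
    with lim have "J = sine_coef f n" by (rule LIMSEQ_unique)
    with J show ?thesis by (simp add: sine_coef_def integral_unique)
  qed
  have "f x - F x = 0"
    by (rule sine_system_complete[OF _ _ x])
       (auto simp: sine_coef_diff cont contF coefF intro!: continuous_intros)
  moreover have "summable (\<lambda>m. summand m x)"
    by (rule summable_comparison_test'[OF summ' bound])
  ultimately have "(\<lambda>m. summand m x) sums f x"
    by (simp add: F_def summable_sums)
  then show ?thesis
    by (simp only: summand_def)
qed

section \<open>Independence of Gaussian exponentials\<close>

lemma summable_exp_squares:
  assumes "t > 0"
  shows "summable (\<lambda>m. exp (- ((real m)\<^sup>2 * t)))"
proof (rule summable_comparison_test')
  show "summable (\<lambda>m. exp (- t) ^ m)" using assms by (intro summable_geometric) auto
  fix m :: nat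
  have "real m * t \<le> (real m)\<^sup>2 * t"
    using assms by (intro mult_right_mono) (cases m; auto simp: power2_eq_square)+
  then show "norm (exp (- ((real m)\<^sup>2 * t))) \<le> exp (- t) ^ m"
    by (simp add: exp_of_nat_mult[symmetric])
qed

text \<open>
  If the coefficients before \<open>n\<close> vanish, multiply the series by \<open>exp (n\<^sup>2 t)\<close>: the term \<open>a n\<close> becomes
  constant, while the rest is dominated by a geometric series of ratio \<open>exp (- t)\<close> that tends to zero
  as \<open>t \<rightarrow> \<infinity>\<close>.
\<close>

theorem exp_squares_independent:
  assumes bound: "\<And>m. \<bar>a m\<bar> \<le> C"
    and zero: "\<And>t. t > 0 \<Longrightarrow> (\<lambda>m. a m * exp (- ((real m)\<^sup>2 * t))) sums 0"
  shows "a n = 0"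
proof (induction n rule: less_induct)
  case (less n)
  have le: "\<bar>a n\<bar> \<le> C * (exp (- t) / (1 - exp (- t)))" if "t > 0" for t
  proof -
    \<comment> \<open>the terms after the \<open>n\<close>-th one, rescaled by \<open>exp (n\<^sup>2 t)\<close>\<close>
    define b where "b i = a (i + Suc n) * exp (- (((real (i + Suc n))\<^sup>2 - (real n)\<^sup>2) * t))" for i
    have "(\<lambda>m. exp ((real n)\<^sup>2 * t) * (a m * exp (- ((real m)\<^sup>2 * t)))) sums (exp ((real n)\<^sup>2 * t) * 0)"
      by (rule sums_mult[OF zero[OF that]])
    moreover have "exp ((real n)\<^sup>2 * t) * (a m * exp (- ((real m)\<^sup>2 * t)))
        = a m * exp (- (((real m)\<^sup>2 - (real n)\<^sup>2) * t))" for m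
      by (simp add: exp_add[symmetric] algebra_simps mult_exp_exp)
    ultimately have "(\<lambda>m. a m * exp (- (((real m)\<^sup>2 - (real n)\<^sup>2) * t))) sums 0" by simp
    then have "b sums (0 - (\<Sum>m<Suc n. a m * exp (- (((real m)\<^sup>2 - (real n)\<^sup>2) * t))))"
      unfolding b_def by (subst sums_iff_shift) simp
    then have b: "b sums (- a n)" using less by simp
    have b_le: "norm (b i) \<le> C * (exp (- t) * exp (- t) ^ i)" for i
    proof -
      have "real (Suc i) \<le> (real (i + Suc n))\<^sup>2 - (real n)\<^sup>2"
      proof -
        have "(real (i + Suc n))\<^sup>2 - (real n)\<^sup>2 = real (Suc i) * (real (Suc i) + 2 * real n)"
          by (simp add: power2_eq_square algebra_simps)
        moreover have "real (Suc i) * 1 \<le> real (Suc i) * (real (Suc i) + 2 * real n)"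
          by (intro mult_left_mono) auto
        ultimately show ?thesis by simp
      qed
      then have "real (Suc i) * t \<le> ((real (i + Suc n))\<^sup>2 - (real n)\<^sup>2) * t"
        using that by (intro mult_right_mono) auto
      then have "exp (- (((real (i + Suc n))\<^sup>2 - (real n)\<^sup>2) * t)) \<le> exp (- (real (Suc i) * t))"
        by simp
      also have "\<dots> = exp (- t) * exp (- t) ^ i"
        by (simp add: exp_of_nat_mult[symmetric] mult_exp_exp algebra_simps)
      finally show ?thesis
        unfolding b_def using bound[of "i + Suc n"] by (auto simp: abs_mult intro!: mult_mono)
    qed
    have geo: "(\<lambda>i. C * (exp (- t) * exp (- t) ^ i)) sums (C * (exp (- t) * (1 / (1 - exp (- t)))))"
      using that by (intro sums_mult geometric_sums) auto
    have "norm (suminf b) \<le> (\<Sum>i. C * (exp (- t) * exp (- t) ^ i))"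
      using b_le by (rule norm_suminf_le) (rule sums_summable[OF geo])
    then show ?thesis using b geo by (simp add: sums_iff)
  qed
  have "((\<lambda>t::real. C * (exp (- t) / (1 - exp (- t)))) \<longlongrightarrow> 0) at_top" by real_asymp
  then have "\<bar>a n\<bar> \<le> 0"
    by (rule tendsto_lowerbound) (use le in \<open>auto intro!: eventually_mono[OF eventually_gt_at_top[of 0]]\<close>)
  then show ?case by simp
qed

section \<open>Classical solutions of the heat equation\<close>

lemma continuous_on_sine_coef:
  fixes f :: "'a::t2_space \<Rightarrow> real \<Rightarrow> real"
  assumes "continuous_on (U \<times> {0..pi}) (\<lambda>(q, x). f q x)"
  shows "continuous_on U (\<lambda>q. sine_coef (f q) m)"
proof -
  have "continuous_on (U \<times> {0..pi}) (\<lambda>p. f (fst p) (snd p))"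
    using assms by (simp add: case_prod_unfold)
  then have "continuous_on (U \<times> cbox 0 pi) (\<lambda>(q, x). f q x * sin (real m * x))"
    unfolding case_prod_unfold box_real(2) by (intro continuous_intros)
  from integral_continuous_on_param[OF this] show ?thesis
    by (simp add: sine_coef_def)
qed

lemma sine_coef_one:
  assumes "m \<ge> 1"
  shows "sine_coef (\<lambda>_. 1) m = (1 - (-1) ^ m) / real m"
proof -
  have "((\<lambda>x. sin (real m * x)) has_integral (- cos (real m * pi) / real m) - (- cos (real m * 0) / real m)) {0..pi}"
    using assms
    by (intro fundamental_theorem_of_calculus)
       (auto simp: has_real_derivative_iff_has_vector_derivative[symmetric] intro!: derivative_eq_intros)
  then show ?thesis
    by (simp add: sine_coef_def integral_unique diff_divide_distrib)
qed

text \<open>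
  This gives a name to the body of the existential statement about derivatives in
  \<open>heat_solution\<close>, so that witnesses can be obtained once and their properties cited separately.
\<close>

definition heat_derivatives ::
  "(real \<Rightarrow> real \<Rightarrow> real) \<Rightarrow> (real \<Rightarrow> real) \<Rightarrow>
   (real \<Rightarrow> real \<Rightarrow> real) \<Rightarrow> (real \<Rightarrow> real \<Rightarrow> real) \<Rightarrow> (real \<Rightarrow> real \<Rightarrow> real) \<Rightarrow> bool"
where
  "heat_derivatives u h ut ux uxx \<longleftrightarrow>
     continuous_on ({0<..<pi} \<times> {0<..}) (\<lambda>(x, t). ut x t) \<and>
     continuous_on ({0<..<pi} \<times> {0<..}) (\<lambda>(x, t). uxx x t) \<and>
     (\<forall>x\<in>{0..pi}. \<forall>t\<in>{0..}.
        ((\<lambda>s. u x s) has_real_derivative ut x t) (at t within {0..}) \<and>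
        ((\<lambda>z. u z t) has_real_derivative ux x t) (at x within {0..pi}) \<and>
        ((\<lambda>z. ux z t) has_real_derivative uxx x t) (at x within {0..pi}) \<and>
        ut x t - uxx x t = h t)"

lemma heat_solution_derivatives:
  assumes "heat_solution u h v g"
  obtains ut ux uxx where "heat_derivatives u h ut ux uxx"
  using assms unfolding heat_solution_def heat_derivatives_def by auto

lemma heat_derivativesD:
  assumes "heat_derivatives u h ut ux uxx"
  shows "continuous_on ({0<..<pi} \<times> {0<..}) (\<lambda>p. ut (fst p) (snd p))"
    and "continuous_on ({0<..<pi} \<times> {0<..}) (\<lambda>p. uxx (fst p) (snd p))"
    and "\<And>x t. x \<in> {0..pi} \<Longrightarrow> t \<ge> 0 \<Longrightarrow> (u x has_real_derivative ut x t) (at t within {0..})"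
    and "\<And>x t. x \<in> {0..pi} \<Longrightarrow> t \<ge> 0 \<Longrightarrow> ((\<lambda>z. u z t) has_real_derivative ux x t) (at x within {0..pi})"
    and "\<And>x t. x \<in> {0..pi} \<Longrightarrow> t \<ge> 0 \<Longrightarrow> ((\<lambda>z. ux z t) has_real_derivative uxx x t) (at x within {0..pi})"
    and "\<And>x t. x \<in> {0..pi} \<Longrightarrow> t \<ge> 0 \<Longrightarrow> ut x t - uxx x t = h t"
  using assms by (auto simp: heat_derivatives_def case_prod_unfold)

lemma heat_solution_diff:
  assumes "heat_solution u h v g" "heat_solution u' h' v' g'"
  shows "heat_solution (\<lambda>x t. u x t - u' x t) (\<lambda>t. h t - h' t) (\<lambda>t. v t - v' t) (\<lambda>x. g x - g' x)"
proof -
  obtain ut ux uxx where d: "heat_derivatives u h ut ux uxx"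
    using assms(1) by (rule heat_solution_derivatives)
  obtain ut' ux' uxx' where d': "heat_derivatives u' h' ut' ux' uxx'"
    using assms(2) by (rule heat_solution_derivatives)
  note * = heat_derivativesD[OF d] and ** = heat_derivativesD[OF d']
  have eq: "(ut x t - ut' x t) - (uxx x t - uxx' x t) = h t - h' t" if "x \<in> {0..pi}" "t \<ge> 0" for x t
    using *(6)[OF that] **(6)[OF that] by simp
  have "continuous_on ({0..pi} \<times> {0..}) (\<lambda>(x, t). u x t - u' x t)"
    using assms by (auto simp: heat_solution_def case_prod_unfold intro!: continuous_intros)
  moreover have "continuous_on ({0<..<pi} \<times> {0<..}) (\<lambda>(x, t). ut x t - ut' x t)"
    and "continuous_on ({0<..<pi} \<times> {0<..}) (\<lambda>(x, t). uxx x t - uxx' x t)"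
    unfolding case_prod_unfold by (intro continuous_on_diff * **)+
  moreover have "\<forall>x\<in>{0..pi}. \<forall>t\<in>{0..}.
         ((\<lambda>s. u x s - u' x s) has_real_derivative ut x t - ut' x t) (at t within {0..}) \<and>
         ((\<lambda>z. u z t - u' z t) has_real_derivative ux x t - ux' x t) (at x within {0..pi}) \<and>
         ((\<lambda>z. ux z t - ux' z t) has_real_derivative uxx x t - uxx' x t) (at x within {0..pi}) \<and>
         (ut x t - ut' x t) - (uxx x t - uxx' x t) = h t - h' t"
    by (intro ballI conjI DERIV_diff * ** eq) auto
  ultimately show ?thesis
    using assms unfolding heat_solution_def
    by (intro conjI exI[of _ "\<lambda>x t. ut x t - ut' x t"] exI[of _ "\<lambda>x t. ux x t - ux' x t"]
          exI[of _ "\<lambda>x t. uxx x t - uxx' x t"]) auto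
qed

text \<open>
  Joint continuity on the closed strip, in the form needed for compositions: the position and the time
  may depend on a common parameter.
\<close>

lemma heat_solution_continuous:
  assumes "heat_solution w h v g" "continuous_on A a" "continuous_on A b"
    and "\<And>q. q \<in> A \<Longrightarrow> a q \<in> {0..pi}" "\<And>q. q \<in> A \<Longrightarrow> b q \<ge> 0"
  shows "continuous_on A (\<lambda>q. w (a q) (b q))"
proof -
  have "continuous_on ({0..pi} \<times> {0..}) (\<lambda>p. w (fst p) (snd p))"
    using assms(1) by (simp add: heat_solution_def case_prod_unfold)
  from continuous_on_compose2[OF this continuous_on_Pair[OF assms(2,3)]] assms(4,5)
  show ?thesis by (simp add: image_subset_iff)
qed

text \<open>
  The source inherits the continuity of \<open>u\<^sub>t - u\<^sub>x\<^sub>x\<close> along any interior line; the midpoint is used.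
  At time \<open>0\<close> nothing of the kind is available, so all arguments involving integrals of
  \<open>h\<close> start at a positive time.
\<close>

lemma heat_source_continuous:
  assumes "heat_solution w h v g"
  shows "continuous_on {0<..} h"
proof -
  obtain ut ux uxx where "heat_derivatives w h ut ux uxx"
    using assms by (rule heat_solution_derivatives)
  note ut = heat_derivativesD(1)[OF this] and uxx = heat_derivativesD(2)[OF this]
    and eq = heat_derivativesD(6)[OF this]
  have "continuous_on {0<..} (\<lambda>t. ut (pi / 2) t - uxx (pi / 2) t)"
    by (intro continuous_on_diff continuous_on_compose2[OF ut, of _ "\<lambda>t. (pi / 2, t)", simplified]
          continuous_on_compose2[OF uxx, of _ "\<lambda>t. (pi / 2, t)", simplified])
       (auto intro!: continuous_intros)
  then show ?thesis
    using eq[of "pi / 2"] by (subst continuous_on_cong[OF refl, of _ h]) auto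
qed

section \<open>Evolution of the sine coefficients\<close>

text \<open>
  The contraction of \<open>[0, \<pi>]\<close> towards its midpoint. For a factor below \<open>1\<close> the image is a compact part of
  the open interval, where the derivatives of a solution are continuous.
\<close>

definition shrink :: "real \<Rightarrow> real \<Rightarrow> real" where
  "shrink l x = pi / 2 + l * (x - pi / 2)"

lemma shrink_1 [simp]: "shrink 1 x = x"
  by (simp add: shrink_def)

lemma shrink_in_closed:
  assumes "l \<in> {0..1}" "x \<in> {0..pi}"
  shows "shrink l x \<in> {0..pi}"
proof -
  have "\<bar>x - pi / 2\<bar> \<le> pi / 2"
    using assms unfolding atLeastAtMost_iff by linarith
  then have "\<bar>l * (x - pi / 2)\<bar> \<le> 1 * (pi / 2)"
    unfolding abs_mult using assms by (intro mult_mono) auto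
  then show ?thesis by (auto simp: shrink_def abs_le_iff)
qed

lemma shrink_in_open:
  assumes "0 < l" "l < 1" "x \<in> {0..pi}"
  shows "shrink l x \<in> {0<..<pi}"
proof -
  have "\<bar>x - pi / 2\<bar> \<le> pi / 2"
    using assms unfolding atLeastAtMost_iff by linarith
  then have "\<bar>l * (x - pi / 2)\<bar> \<le> l * (pi / 2)"
    unfolding abs_mult using assms by (intro mult_mono) auto
  also have "\<dots> < 1 * (pi / 2)" using assms by (intro mult_strict_right_mono) auto
  finally show ?thesis by (auto simp: shrink_def abs_less_iff)
qed

lemma continuous_on_shrink [continuous_intros]:
  "continuous_on A f \<Longrightarrow> continuous_on A g \<Longrightarrow> continuous_on A (\<lambda>q. shrink (f q) (g q))"
  unfolding shrink_def by (intro continuous_intros)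

text \<open>
  The function \<open>w (shrink l x) t\<close> solves \<open>l\<^sup>2 W\<^sub>t - W\<^sub>x\<^sub>x = l\<^sup>2 h\<close>, and for positive times \<open>W\<^sub>t\<close> and \<open>W\<^sub>x\<^sub>x\<close>
  are continuous up to the ends of \<open>[0, \<pi>]\<close>. Integrating by parts twice against \<open>sin (m x)\<close> leaves only the values of \<open>W\<close> at the ends.
  Integration in time followed by an exchange of integrals replaces \<open>W\<^sub>t\<close> by an
  increment of \<open>W\<close>. Neither side of the resulting identity contains a derivative of \<open>w\<close>, so it makes
  sense for \<open>l = 1\<close> too.
\<close>

lemma sine_coef_shrunk_evolution:
  assumes heat: "heat_solution w h v g" and st: "0 < s" "s \<le> t" and l: "0 < l" "l < 1"
  shows "l\<^sup>2 * (sine_coef (\<lambda>x. w (shrink l x) t) m - sine_coef (\<lambda>x. w (shrink l x) s) m) =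
    integral {s..t} (\<lambda>r. real m * (w (shrink l 0) r - (-1) ^ m * w (shrink l pi) r)
      - (real m)\<^sup>2 * sine_coef (\<lambda>x. w (shrink l x) r) m + l\<^sup>2 * (h r * sine_coef (\<lambda>_. 1) m))"
proof -
  obtain wt wx wxx where "heat_derivatives w h wt wx wxx"
    using heat by (rule heat_solution_derivatives)
  note wt = heat_derivativesD(1)[OF this] and dt = heat_derivativesD(3)[OF this]
    and dx = heat_derivativesD(4)[OF this] and dxx = heat_derivativesD(5)[OF this]
    and eq = heat_derivativesD(6)[OF this]
  note inside = shrink_in_open[OF l]
  have deriv_shrink: "(shrink l has_real_derivative l) (at x within A)" for x A
    unfolding shrink_def by (auto intro!: derivative_eq_intros)
  have wt': "continuous_on (A \<times> B) (\<lambda>p. wt (shrink l (fst p)) (snd p))"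
    if "A \<subseteq> {0..pi}" "B \<subseteq> {0<..}" for A B
    by (rule continuous_on_compose2[OF wt, of _ "\<lambda>p. (shrink l (fst p), snd p)", simplified])
       (use inside that in \<open>auto intro!: continuous_intros\<close>)
  have space: "integral {0..pi} (\<lambda>x. l\<^sup>2 * wt (shrink l x) r * sin (real m * x)) =
      real m * (w (shrink l 0) r - (-1) ^ m * w (shrink l pi) r)
      - (real m)\<^sup>2 * sine_coef (\<lambda>x. w (shrink l x) r) m + l\<^sup>2 * (h r * sine_coef (\<lambda>_. 1) m)"
    if "r > 0" for r
  proof -
    \<comment> \<open>an antiderivative of \<open>W\<^sub>x\<^sub>x sin (m x) + m\<^sup>2 W sin (m x)\<close>, where \<open>W x = w (shrink l x) r\<close>\<close>
    define \<Phi> where "\<Phi> x = l * wx (shrink l x) r * sin (real m * x) - real m * w (shrink l x) r * cos (real m * x)" for x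
    have "((\<lambda>x. l\<^sup>2 * (wt (shrink l x) r - h r) * sin (real m * x)
          + (real m)\<^sup>2 * (w (shrink l x) r * sin (real m * x))) has_integral (\<Phi> pi - \<Phi> 0)) {0..pi}"
    proof (rule fundamental_theorem_of_calculus)
      fix x assume x: "x \<in> {0..pi}"
      have at: "at (shrink l x) within {0..pi} = at (shrink l x)"
        using inside[OF x] by (intro at_within_interior) simp
      have x': "shrink l x \<in> {0..pi}" using inside[OF x] by simp
      have h: "wxx (shrink l x) r = wt (shrink l x) r - h r"
        using eq[OF x', of r] \<open>r > 0\<close> by simp
      have "((\<lambda>x. w (shrink l x) r) has_real_derivative wx (shrink l x) r * l) (at x within {0..pi})"
        by (rule DERIV_chain2[OF _ deriv_shrink]) (use dx[OF x', of r] \<open>r > 0\<close> at in simp)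
      moreover have "((\<lambda>x. wx (shrink l x) r) has_real_derivative wxx (shrink l x) r * l) (at x within {0..pi})"
        by (rule DERIV_chain2[OF _ deriv_shrink]) (use dxx[OF x', of r] \<open>r > 0\<close> at in simp)
      ultimately
      have "(\<Phi> has_real_derivative l\<^sup>2 * wxx (shrink l x) r * sin (real m * x)
          + (real m)\<^sup>2 * (w (shrink l x) r * sin (real m * x))) (at x within {0..pi})"
        unfolding \<Phi>_def by (auto intro!: derivative_eq_intros simp: algebra_simps power2_eq_square)
      then show "(\<Phi> has_vector_derivative l\<^sup>2 * (wt (shrink l x) r - h r) * sin (real m * x)
          + (real m)\<^sup>2 * (w (shrink l x) r * sin (real m * x))) (at x within {0..pi})"
        by (simp add: h has_real_derivative_iff_has_vector_derivative)
    qed simp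
    moreover have "\<Phi> pi - \<Phi> 0 = real m * (w (shrink l 0) r - (-1) ^ m * w (shrink l pi) r)"
      by (simp add: \<Phi>_def algebra_simps)
    moreover have "((\<lambda>x. w (shrink l x) r * sin (real m * x)) has_integral sine_coef (\<lambda>x. w (shrink l x) r) m) {0..pi}"
      unfolding sine_coef_def
      by (intro integrable_integral sine_coef_integrable heat_solution_continuous[OF heat] continuous_intros)
         (use \<open>r > 0\<close> shrink_in_closed[of l] l in auto)
    moreover have "((\<lambda>x. 1 * sin (real m * x)) has_integral sine_coef (\<lambda>_. 1) m) {0..pi}"
      unfolding sine_coef_def by (intro integrable_integral sine_coef_integrable continuous_intros)
    ultimately have "((\<lambda>x. (l\<^sup>2 * (wt (shrink l x) r - h r) * sin (real m * x)
          + (real m)\<^sup>2 * (w (shrink l x) r * sin (real m * x)))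
          - (real m)\<^sup>2 * (w (shrink l x) r * sin (real m * x)) + (l\<^sup>2 * h r) * (1 * sin (real m * x)))
        has_integral real m * (w (shrink l 0) r - (-1) ^ m * w (shrink l pi) r)
          - (real m)\<^sup>2 * sine_coef (\<lambda>x. w (shrink l x) r) m + (l\<^sup>2 * h r) * sine_coef (\<lambda>_. 1) m) {0..pi}"
      by (intro has_integral_add has_integral_diff has_integral_mult_right) auto
    then show ?thesis
      by (intro integral_unique) (simp add: algebra_simps)
  qed
  have time: "integral {s..t} (\<lambda>r. l\<^sup>2 * wt (shrink l x) r * sin (real m * x)) =
      l\<^sup>2 * (w (shrink l x) t - w (shrink l x) s) * sin (real m * x)" if "x \<in> {0..pi}" for x
  proof -
    have "(wt (shrink l x) has_integral w (shrink l x) t - w (shrink l x) s) {s..t}"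
    proof (rule fundamental_theorem_of_calculus[OF st(2)])
      fix r assume r: "r \<in> {s..t}"
      have "(w (shrink l x) has_real_derivative wt (shrink l x) r) (at r within {0..})"
        using dt[of "shrink l x" r] inside[OF that] r st by auto
      then have "(w (shrink l x) has_real_derivative wt (shrink l x) r) (at r within {s..t})"
        by (rule DERIV_subset) (use st in auto)
      then show "(w (shrink l x) has_vector_derivative wt (shrink l x) r) (at r within {s..t})"
        by (simp add: has_real_derivative_iff_has_vector_derivative)
    qed
    then show ?thesis by (simp add: integral_unique)
  qed
  have "integral {s..t} (\<lambda>r. integral {0..pi} (\<lambda>x. l\<^sup>2 * wt (shrink l x) r * sin (real m * x)))
      = integral {0..pi} (\<lambda>x. integral {s..t} (\<lambda>r. l\<^sup>2 * wt (shrink l x) r * sin (real m * x)))"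
  proof -
    have "continuous_on (cbox (0, s) (pi, t)) (\<lambda>(x, r). l\<^sup>2 * wt (shrink l x) r * sin (real m * x))"
      unfolding cbox_Pair_eq case_prod_unfold
      by (intro continuous_intros wt') (use st in auto)
    from integral_swap_continuous[OF this] show ?thesis by simp
  qed
  also have "\<dots> = integral {0..pi} (\<lambda>x. l\<^sup>2 * (w (shrink l x) t * sin (real m * x) - w (shrink l x) s * sin (real m * x)))"
    by (intro integral_cong) (simp only: time, simp add: algebra_simps)
  also have "\<dots> = l\<^sup>2 * (sine_coef (\<lambda>x. w (shrink l x) t) m - sine_coef (\<lambda>x. w (shrink l x) s) m)"
    unfolding sine_coef_def integral_mult_right
    by (subst integral_diff)
       ((intro sine_coef_integrable heat_solution_continuous[OF heat] continuous_intros;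
         use st shrink_in_closed[of l] l in auto)+, rule refl)
  finally have "l\<^sup>2 * (sine_coef (\<lambda>x. w (shrink l x) t) m - sine_coef (\<lambda>x. w (shrink l x) s) m) =
      integral {s..t} (\<lambda>r. integral {0..pi} (\<lambda>x. l\<^sup>2 * wt (shrink l x) r * sin (real m * x)))" ..
  also have "\<dots> = integral {s..t} (\<lambda>r. real m * (w (shrink l 0) r - (-1) ^ m * w (shrink l pi) r)
      - (real m)\<^sup>2 * sine_coef (\<lambda>x. w (shrink l x) r) m + l\<^sup>2 * (h r * sine_coef (\<lambda>_. 1) m))"
    by (intro integral_cong space) (use st in auto)
  finally show ?thesis .
qed

text \<open>
  Both sides of the identity on the compressed strip depend continuously on \<open>l \<in> [0, 1]\<close>, as \<open>w\<close> is
  continuous up to the boundary. An identity on \<open>(0, 1)\<close> therefore persists at \<open>l = 1\<close>.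
\<close>

lemma sine_coef_evolution:
  assumes heat: "heat_solution w h v g" and st: "0 < s" "s \<le> t"
  shows "sine_coef (\<lambda>x. w x t) m - sine_coef (\<lambda>x. w x s) m =
    integral {s..t} (\<lambda>r. real m * v r - (real m)\<^sup>2 * sine_coef (\<lambda>x. w x r) m + h r * sine_coef (\<lambda>_. 1) m)"
proof -
  define L where "L l = l\<^sup>2 * (sine_coef (\<lambda>x. w (shrink l x) t) m - sine_coef (\<lambda>x. w (shrink l x) s) m)" for l
  define R where "R l = integral {s..t} (\<lambda>r. real m * (w (shrink l 0) r - (-1) ^ m * w (shrink l pi) r)
      - (real m)\<^sup>2 * sine_coef (\<lambda>x. w (shrink l x) r) m + l\<^sup>2 * (h r * sine_coef (\<lambda>_. 1) m))" for l
  have coef: "continuous_on ({0..1} \<times> {s..t}) (\<lambda>q. sine_coef (\<lambda>x. w (shrink (fst q) x) (snd q)) m)"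
    using st shrink_in_closed unfolding case_prod_unfold
    by (intro continuous_on_sine_coef) 
       (auto simp: case_prod_unfold simp del: atLeastAtMost_iff intro!: heat_solution_continuous[OF heat] continuous_intros; auto)
  have "continuous_on {0..1} (\<lambda>l. sine_coef (\<lambda>x. w (shrink l x) r) m)" if "r \<in> {s..t}" for r
    using continuous_on_compose2[OF coef, of "{0..1}" "\<lambda>l. (l, r)"] that
    by (simp add: image_subset_iff continuous_on_Pair)
  then have L: "continuous_on {0..1} L"
    unfolding L_def using st by (intro continuous_intros) auto
  have side: "continuous_on ({0..1} \<times> {s..t}) (\<lambda>q. w (shrink (fst q) z) (snd q))" if "z \<in> {0..pi}" for z
    by (intro heat_solution_continuous[OF heat] continuous_intros)
       (use st shrink_in_closed[OF _ that] in auto)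
  have source: "continuous_on ({0..1::real} \<times> {s..t}) (\<lambda>q. h (snd q))"
    by (rule continuous_on_compose2[OF heat_source_continuous[OF heat]])
       (use st in \<open>auto intro!: continuous_intros\<close>)
  have R: "continuous_on {0..1} R"
    unfolding R_def box_real(2)[symmetric]
    by (rule integral_continuous_on_param, unfold case_prod_unfold box_real(2))
       (intro continuous_intros side source coef; simp)
  have "L 1 - R 1 = 0"
  proof (rule continuous_constant_on_closure[of "{0<..<1}" "\<lambda>l. L l - R l"])
    show "continuous_on (closure {0<..<1}) (\<lambda>l. L l - R l)"
      using L R by (auto intro!: continuous_intros)
    show "L l - R l = 0" if "l \<in> {0<..<1}" for l
      using sine_coef_shrunk_evolution[OF heat st, of l] that by (simp add: L_def R_def)
  qed simp
  moreover have "R 1 = integral {s..t} (\<lambda>r. real m * v r - (real m)\<^sup>2 * sine_coef (\<lambda>x. w x r) m + h r * sine_coef (\<lambda>_. 1) m)"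
    unfolding R_def by (intro integral_cong) (use heat st in \<open>auto simp: heat_solution_def\<close>)
  ultimately show ?thesis by (simp add: L_def)
qed

lemma sine_coef_continuous_in_time:
  assumes heat: "heat_solution w h v g"
  shows "continuous_on {0..} (\<lambda>t. sine_coef (\<lambda>x. w x t) m)"
  by (intro continuous_on_sine_coef)
     (auto simp: case_prod_unfold intro!: heat_solution_continuous[OF heat] continuous_intros)

lemma sine_coef_ode:
  assumes heat: "heat_solution w h v g" and t: "t > 0"
  shows "((\<lambda>t. sine_coef (\<lambda>x. w x t) m) has_real_derivative
    real m * v t - (real m)\<^sup>2 * sine_coef (\<lambda>x. w x t) m + h t * sine_coef (\<lambda>_. 1) m) (at t)"
proof -
  define S where "S t = sine_coef (\<lambda>x. w x t) m" for t
  define F where "F r = real m * v r - (real m)\<^sup>2 * S r + h r * sine_coef (\<lambda>_. 1) m" for r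
  have "continuous_on {t/2..2*t} (\<lambda>r. w 0 r)"
    using t by (intro heat_solution_continuous[OF heat] continuous_intros) auto
  then have v: "continuous_on {t/2..2*t} v"
    by (rule continuous_on_eq) (use heat t in \<open>auto simp: heat_solution_def\<close>)
  have "continuous_on {t/2..2*t} F"
    unfolding F_def S_def using t
    by (intro continuous_intros v continuous_on_subset[OF sine_coef_continuous_in_time[OF heat]]
        continuous_on_subset[OF heat_source_continuous[OF heat]]) auto
  then have "((\<lambda>x. integral {t/2..x} F) has_real_derivative F t) (at t within {t/2..2*t})"
    using t by (intro integral_has_real_derivative) auto
  then have "((\<lambda>x. S (t/2) + integral {t/2..x} F) has_real_derivative F t) (at t within {t/2..2*t})"
    by (auto intro!: derivative_eq_intros)
  then have "(S has_real_derivative F t) (at t within {t/2..2*t})"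
  proof (rule has_field_derivative_transform_within[where d = 1])
    fix x assume "x \<in> {t/2..2*t}"
    then show "S (t/2) + integral {t/2..x} F = S x"
      using sine_coef_evolution[OF heat, of "t/2" x m] t by (simp add: S_def F_def[abs_def])
  qed (use t in auto)
  moreover have "at t within {t/2..2*t} = at t"
    using t by (intro at_within_interior) simp
  ultimately show ?thesis by (simp add: S_def[abs_def] F_def)
qed

text \<open>
  The differential equation for the coefficient holds for positive times only, but continuity at
  time \<open>0\<close> connects it with the initial value.
\<close>

lemma sine_coef_decay:
  assumes heat: "heat_solution w h v g"
    and zero: "\<And>t. t > 0 \<Longrightarrow> h t = 0" "\<And>t. t > 0 \<Longrightarrow> v t = 0" and t: "t \<ge> 0"
  shows "sine_coef (\<lambda>x. w x t) m = sine_coef (\<lambda>x. w x 0) m * exp (- ((real m)\<^sup>2 * t))"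
proof (cases "t = 0")
  case False
  define S where "S t = sine_coef (\<lambda>x. w x t) m" for t
  have "exp ((real m)\<^sup>2 * t) * S t = exp ((real m)\<^sup>2 * 0) * S 0"
  proof (rule DERIV_isconst_end[of 0 t "\<lambda>t. exp ((real m)\<^sup>2 * t) * S t"])
    show "continuous_on {0..t} (\<lambda>t. exp ((real m)\<^sup>2 * t) * S t)"
      unfolding S_def
      by (intro continuous_intros continuous_on_subset[OF sine_coef_continuous_in_time[OF heat]]) auto
    fix r assume "0 < r" "r < t"
    then have "(S has_real_derivative - (real m)\<^sup>2 * S r) (at r)"
      using sine_coef_ode[OF heat, of r m] zero[of r] by (simp add: S_def[abs_def])
    then show "((\<lambda>t. exp ((real m)\<^sup>2 * t) * S t) has_real_derivative 0) (at r)"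
      by (auto intro!: derivative_eq_intros)
  qed (use False t in auto)
  then show ?thesis by (simp add: S_def exp_minus field_simps)
qed simp

lemma coef_eq_sine_coef: "coef w m t = sqrt (2 / pi) * sine_coef (\<lambda>x. w x t) m"
proof -
  have "coef w m t = integral {0..pi} (\<lambda>x. sqrt (2 / pi) * (w x t * sin (real m * x)))"
    by (simp only: coef_def eigf_def mult_ac)
  then show ?thesis by (simp only: sine_coef_def integral_mult_right)
qed

section \<open>Uniqueness\<close>

text \<open>
  The relations for \<open>m = 1\<close> and \<open>m = 3\<close> remove source and boundary value at positive times; the
  record at \<open>y\<close> then removes the initial value, one coefficient at a time.
\<close>

theorem
  assumes y: "y \<in> {0<..<pi}" "\<And>m. m \<ge> 1 \<Longrightarrow> eigf m y \<noteq> 0"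
    and heat: "heat_solution w h v g"
    and data: "\<And>t. t \<ge> 0 \<Longrightarrow> coef w 1 t = 0" "\<And>t. t \<ge> 0 \<Longrightarrow> coef w 3 t = 0" "\<And>t. t \<ge> 0 \<Longrightarrow> w y t = 0"
  shows heat_solution_eq_0: "\<And>x t. x \<in> {0..pi} \<Longrightarrow> t \<ge> 0 \<Longrightarrow> w x t = 0"
    and heat_source_eq_0: "\<And>t. t \<ge> 0 \<Longrightarrow> h t = 0"
proof -
  have cont: "continuous_on {0..pi} (\<lambda>x. w x t)" if "t \<ge> 0" for t
    using that by (intro heat_solution_continuous[OF heat] continuous_intros) auto
  \<comment> \<open>An identically vanishing coefficient turns its differential equation into a linear relation between \<open>v\<close> and \<open>h\<close>.\<close>
  have balance: "real m * v t + h t * sine_coef (\<lambda>_. 1) m = 0" if "t > 0" and m: "m = 1 \<or> m = 3" for m t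
  proof -
    have S: "sine_coef (\<lambda>x. w x r) m = 0" if "r \<ge> 0" for r
      using data(1,2)[OF that] m by (auto simp: coef_eq_sine_coef)
    have "((\<lambda>r. sine_coef (\<lambda>x. w x r) m) has_real_derivative 0) (at t)"
      by (rule has_field_derivative_transform_within[OF DERIV_const[of 0], where d = t])
         (use \<open>t > 0\<close> S in \<open>auto simp: dist_real_def\<close>)
    from DERIV_unique[OF this sine_coef_ode[OF heat \<open>t > 0\<close>]] show ?thesis
      using S[of t] \<open>t > 0\<close> by simp
  qed
  have lin: "v t + 2 * h t = 0" "3 * v t + 2 / 3 * h t = 0" if "t > 0" for t
    using balance[OF that, of 1] balance[OF that, of 3] sine_coef_one[of 1] sine_coef_one[of 3]
    by (auto simp: algebra_simps)
  have zero: "h t = 0" "v t = 0" if "t > 0" for t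
    using lin[OF that] by linarith+
  define b where "b m = sine_coef (\<lambda>x. w x 0) m" for m
  have decay: "sine_coef (\<lambda>x. w x t) m = b m * exp (- ((real m)\<^sup>2 * t))" if "t \<ge> 0" for t m
    unfolding b_def by (rule sine_coef_decay[OF heat zero that])
  obtain C where C: "\<And>m. \<bar>b m\<bar> \<le> C"
    using sine_coef_bounded[OF cont[OF order_refl]] unfolding b_def by blast
  have "b n * sin (real n * y) = 0" for n
  proof (rule exp_squares_independent[where a = "\<lambda>m. b m * sin (real m * y)" and C = C])
    show "\<bar>b m * sin (real m * y)\<bar> \<le> C" for m
    proof -
      have "\<bar>b m\<bar> * \<bar>sin (real m * y)\<bar> \<le> \<bar>b m\<bar> * 1" by (intro mult_left_mono) auto
      then show ?thesis using C[of m] by (simp add: abs_mult)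
    qed
    fix t :: real assume t: "t > 0"
    have "summable (\<lambda>m. \<bar>sine_coef (\<lambda>x. w x t) m\<bar>)"
    proof (rule summable_comparison_test')
      show "summable (\<lambda>m. C * exp (- ((real m)\<^sup>2 * t)))"
        by (intro summable_mult summable_exp_squares t)
      show "norm \<bar>sine_coef (\<lambda>x. w x t) m\<bar> \<le> C * exp (- ((real m)\<^sup>2 * t))" for m
        using t C[of m] by (simp add: decay abs_mult)
    qed
    then have "(\<lambda>m. 2 / pi * sine_coef (\<lambda>x. w x t) m * sin (real m * y)) sums w y t"
      using t y by (intro sine_expansion cont) auto
    then have "(\<lambda>m. pi / 2 * (2 / pi * sine_coef (\<lambda>x. w x t) m * sin (real m * y))) sums (pi / 2 * 0)"
      using data(3)[of t] t by (intro sums_mult) auto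
    then show "(\<lambda>m. b m * sin (real m * y) * exp (- ((real m)\<^sup>2 * t))) sums 0"
      using t by (simp add: decay mult_ac)
  qed
  then have b: "b m = 0" if "m \<ge> 1" for m
    using y(2)[OF that] by (auto simp: eigf_def)
  show w: "w x t = 0" if "x \<in> {0..pi}" "t \<ge> 0" for x t
    by (rule sine_system_complete[OF cont[OF that(2)] _ that(1)]) (simp add: decay that b)
  show "h t = 0" if t: "t \<ge> 0" for t
  proof -
    obtain wt wx wxx where d: "heat_derivatives w h wt wx wxx"
      using heat by (rule heat_solution_derivatives)
    \<comment> \<open>The source is read off from the equation at the midpoint, because all derivatives of \<open>w\<close> vanish there.
      At time \<open>0\<close> the time derivative is one-sided, so its uniqueness needs a nontrivial filter.\<close>
    have interior: "at x within {0..pi} = at x" if "x \<in> {0<..<pi}" for x :: real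
      using that by (intro at_within_interior) simp
    have wx: "wx x t = 0" if x: "x \<in> {0<..<pi}" for x
    proof (rule DERIV_unique)
      show "((\<lambda>z. w z t) has_real_derivative wx x t) (at x)"
        using heat_derivativesD(4)[OF d, of x t] x t by (simp add: interior)
      show "((\<lambda>z. w z t) has_real_derivative 0) (at x)"
        by (rule has_field_derivative_transform_within_open[OF DERIV_const[of 0] open_greaterThanLessThan x])
           (use t w in auto)
    qed
    have half: "pi / 2 \<in> {0<..<pi}" by simp
    have "wxx (pi / 2) t = 0"
    proof (rule DERIV_unique)
      show "((\<lambda>z. wx z t) has_real_derivative wxx (pi / 2) t) (at (pi / 2))"
        using heat_derivativesD(5)[OF d, of "pi / 2" t] t by (simp add: interior)
      show "((\<lambda>z. wx z t) has_real_derivative 0) (at (pi / 2))"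
        by (rule has_field_derivative_transform_within_open[OF DERIV_const[of 0] open_greaterThanLessThan half])
           (use wx in auto)
    qed
    moreover have "wt (pi / 2) t = 0"
    proof (rule has_field_derivative_unique)
      show "(w (pi / 2) has_real_derivative wt (pi / 2) t) (at t within {0..})"
        using t by (intro heat_derivativesD(3)[OF d]) auto
      show "(w (pi / 2) has_real_derivative 0) (at t within {0..})"
        by (rule has_field_derivative_transform_within[OF DERIV_const[of 0], where d = 1])
           (use t w in auto)
      have "at_right t \<le> at t within {0..}"
        using t by (intro at_le) auto
      then show "at t within {0..} \<noteq> bot"
        using trivial_limit_at_right_real[of t] by (metis le_bot)
    qed
    ultimately show ?thesis
      using heat_derivativesD(6)[OF d, of "pi / 2" t] t by simp
  qed
qed

theorem theorem1:
  fixes u u' :: "real \<Rightarrow> real \<Rightarrow> real"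
    and h v g h' v' g' :: "real \<Rightarrow> real"
    and y :: real
  assumes "y \<in> {0<..<pi}"
    and "\<And>m. m \<ge> 1 \<Longrightarrow> eigf m y \<noteq> 0"
    and "heat_solution u h v g"
    and "heat_solution u' h' v' g'"
    and "\<And>t. t \<ge> 0 \<Longrightarrow> coef u 1 t = coef u' 1 t"
    and "\<And>t. t \<ge> 0 \<Longrightarrow> coef u 3 t = coef u' 3 t"
    and "\<And>t. t \<ge> 0 \<Longrightarrow> u y t = u' y t"
  shows "(\<forall>t\<ge>0. h t = h' t) \<and> (\<forall>t\<ge>0. v t = v' t) \<and> (\<forall>x\<in>{0..pi}. g x = g' x)"
proof -
  have heat: "heat_solution (\<lambda>x t. u x t - u' x t) (\<lambda>t. h t - h' t) (\<lambda>t. v t - v' t) (\<lambda>x. g x - g' x)"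
    using assms(3,4) by (rule heat_solution_diff)
  have coef: "coef (\<lambda>x t. u x t - u' x t) m t = coef u m t - coef u' m t" if "t \<ge> 0" for m t
  proof -
    have "continuous_on {0..pi} (\<lambda>x. u x t)" "continuous_on {0..pi} (\<lambda>x. u' x t)"
      using that by (intro heat_solution_continuous[OF assms(3)] heat_solution_continuous[OF assms(4)]
            continuous_intros; simp)+
    then show ?thesis
      by (simp add: coef_eq_sine_coef sine_coef_diff right_diff_distrib)
  qed
  have u: "u x t - u' x t = 0" if "x \<in> {0..pi}" "t \<ge> 0" for x t
    by (rule heat_solution_eq_0[OF assms(1,2) heat _ _ _ that]) (use assms coef in auto)
  have "h t - h' t = 0" if "t \<ge> 0" for t
    by (rule heat_source_eq_0[OF assms(1,2) heat _ _ _ that]) (use assms coef in auto)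
  moreover have "v t = v' t" if "t \<ge> 0" for t
    using assms(3,4) u[of 0 t] that by (auto simp: heat_solution_def)
  moreover have "g x = g' x" if "x \<in> {0..pi}" for x
    using assms(3,4) u[of x 0] that by (auto simp: heat_solution_def)
  ultimately show ?thesis by simp
qed

end
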